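(* Let $w^0,w^1,w^2,\dots:\mathbb{I}\to[0,1]$ be arbitrary weight functions, let $x^0\in\mathbb{R}^n$ be arbitrary, and let $x^{k+1}=\sum_{\iota\in\mathbb{I}}w^k(\iota)P[\iota](x^k)$ for all $k\ge 0$. Suppose $\bigcap\mathcal{C}$ is an $n$-dimensional subset of $\mathbb{R}^n$ (i.e., $\bigcap\mathcal{C}$ contains an $n$-dimensional simplex). Then the sequence $x^0,x^1,x^2,\dots$ converges, and its limit lies in $C_j$ for every index $j$ such that $\sum_{k=0}^{\infty}\sum_{\iota\in\mathbb{I}\langle j\rangle}w^k(\iota)=\infty$. In particular, the sequence $x^0,x^1,x^2,\dots$ converges to a point in $\bigcap\mathcal{C}$ if $\sum_{k=0}^{\infty}\sum_{\iota\in\mathbb{I}\langle j\rangle}w^k(\iota)=\infty$ for every index $j$ such that $C_j\neq\mathbb{R}^n$.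
   Context: Fix a positive integer $n$ and an infinite sequence $C_1,C_2,C_3,\dots$ of closed convex subsets of $\mathbb{R}^n$ such that $\bigcap_{i=1}^\infty C_i\neq\emptyset$ and at least one $C_i$ is not $\mathbb{R}^n$. Write $\mathcal{C}=\{C_i\mid 1\le i<\infty\}$, so $\bigcap\mathcal{C}=\bigcap_{i=1}^\infty C_i$. An index is a positive integer. For each index $j$, $P_j:\mathbb{R}^n\to C_j$ maps each $q$ to the unique point of $C_j$ closest to $q$ in the Euclidean norm. $\mathbb{I}$ is the set of all nonempty finite sequences of indices (repetitions allowed); its members are called index vectors. For $\iota=(\iota_1,\dots,\iota_m)\in\mathbb{I}$, $P[\iota]=P_{\iota_m}\circ P_{\iota_{m-1}}\circ\dots\circ P_{\iota_1}$. For an index $j$, $\mathbb{I}\langle j\rangle$ is the set of index vectors in which $j$ occurs. A weight function is a function $w:\mathbb{I}\to[0,1]$ with finite support such that $\sum_{\iota\in\mathbb{I}}w(\iota)=1$. *)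

theory Defs
  imports "HOL-Analysis.Analysis"
begin

text \<open>A sequence \<open>C\<^sub>1, C\<^sub>2, \<dots>\<close> is a function on \<^typ>\<open>nat\<close> of which only the values at
  positive arguments are used. Likewise only the values of a weight function on
  \<open>index_vectors\<close> are used.\<close>

definition indices :: "nat set" where
  "indices = {1..}"

definition index_vectors :: "nat list set" where
  "index_vectors = {\<iota>. \<iota> \<noteq> [] \<and> set \<iota> \<subseteq> indices}"

definition index_vectors_with :: "nat \<Rightarrow> nat list set" where
  "index_vectors_with j = {\<iota> \<in> index_vectors. j \<in> set \<iota>}"

text \<open>The head of the list is projected on first:
  \<open>proj_comp C [i\<^sub>1, \<dots>, i\<^sub>m] = P\<^sub>i\<^sub>m \<circ> \<dots> \<circ> P\<^sub>i\<^sub>1\<close>, with \<open>P\<^sub>j = closest_point (C j)\<close>.\<close>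

definition proj_comp :: "(nat \<Rightarrow> 'a::euclidean_space set) \<Rightarrow> nat list \<Rightarrow> 'a \<Rightarrow> 'a" where
  "proj_comp C \<iota> = fold (\<lambda>j. closest_point (C j)) \<iota>"

definition support :: "(nat list \<Rightarrow> real) \<Rightarrow> nat list set" where
  "support w = {\<iota> \<in> index_vectors. w \<iota> \<noteq> 0}"

text \<open>Since supports are finite, each sum over (a subset of) \<open>index_vectors\<close> is written as the
  finite sum over its intersection with the support.\<close>

definition weight_function :: "(nat list \<Rightarrow> real) \<Rightarrow> bool" where
  "weight_function w \<longleftrightarrow>
     (\<forall>\<iota>\<in>index_vectors. w \<iota> \<in> {0..1}) \<and> finite (support w) \<and> (\<Sum>\<iota>\<in>support w. w \<iota>) = 1"

definition weight_of_index :: "(nat list \<Rightarrow> real) \<Rightarrow> nat \<Rightarrow> real" where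
  "weight_of_index w j = (\<Sum>\<iota>\<in>support w \<inter> index_vectors_with j. w \<iota>)"

end

theory Submission
  imports Defs
begin

text \<open>
  The common part of the sets contains a ball of some radius \<open>r\<close> about some \<open>c\<close>. Projecting a
  point on a convex set that contains this ball does more than shorten the distance to \<open>c\<close>: the
  squared distance drops by at least \<open>2 * r\<close> times the length of the move
  (\<open>closest_point_ball_decrease\<close>). The bound is linear in the length of the move, so it adds up
  along the polygonal path that a composition of projections traces (\<open>path_length_decrease\<close>), and
  it survives convex combinations because the squared norm is convex. As the squared distance to
  \<open>c\<close> stays nonnegative, the weighted path lengths of all the steps have a finite total
  (\<open>mean_path_length_summable\<close>).

  Both conclusions follow from this total. A step moves the iterate by no more than its weighted
  path length, so the sequence has finite length and converges. A path on which \<open>C j\<close> is visited is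
  at least as long as the distance of its start from \<open>C j\<close>; if the limit were outside the closed
  set \<open>C j\<close>, these distances would be bounded below from some step on, and the total weight of the
  index vectors containing \<open>j\<close> would be finite.
\<close>

section \<open>Projections, convex combinations and simplices\<close>

text \<open>The obtuse angle property of the projection is applied not to the centre but to the point
  of the ball that lies farthest in the direction \<open>q - p\<close> of the move; this produces the term
  that is linear in \<open>dist q p\<close>.\<close>

lemma closest_point_ball_decrease:
  fixes S :: "'a::euclidean_space set"
  assumes "convex S" "closed S" "cball c r \<subseteq> S" "0 \<le> r"
  shows "2 * r * dist q (closest_point S q) \<le> (dist q c)\<^sup>2 - (dist (closest_point S q) c)\<^sup>2"
proof -
  define p where "p = closest_point S q"
  define z where "z = c + r *\<^sub>R sgn (q - p)"
  have "dist c z \<le> r"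
    using \<open>0 \<le> r\<close> by (simp add: z_def dist_norm norm_sgn)
  then have "z \<in> S"
    using assms(3) by auto
  then have "(q - p) \<bullet> (z - p) \<le> 0"
    unfolding p_def using assms(1,2) closest_point_dot by blast
  moreover have "(q - p) \<bullet> sgn (q - p) = norm (q - p)"
    by (cases "q = p") (simp_all add: sgn_div_norm dot_square_norm power2_eq_square)
  ultimately have "r * norm (q - p) \<le> (q - p) \<bullet> (p - c)"
    by (simp add: z_def inner_simps)
  moreover have "(norm (q - c))\<^sup>2 = (norm (q - p))\<^sup>2 + 2 * ((q - p) \<bullet> (p - c)) + (norm (p - c))\<^sup>2"
    unfolding power2_norm_eq_inner by (simp add: inner_simps inner_commute)
  ultimately show ?thesis
    unfolding p_def[symmetric] dist_norm
    using zero_le_power2[of "norm (q - p)"] by linarith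
qed

lemma norm_convex_combination_power2_le:
  fixes v :: "'i \<Rightarrow> 'a::real_inner"
  assumes "sum u I = 1" "\<And>i. i \<in> I \<Longrightarrow> 0 \<le> u i"
  shows "(norm (\<Sum>i\<in>I. u i *\<^sub>R v i))\<^sup>2 \<le> (\<Sum>i\<in>I. u i * (norm (v i))\<^sup>2)"
proof -
  define m where "m = (\<Sum>i\<in>I. u i *\<^sub>R v i)"
  \<comment> \<open>The squared norm lies above its tangent at the mean \<open>m\<close>.\<close>
  have tangent: "2 * (v i \<bullet> m) - m \<bullet> m \<le> (norm (v i))\<^sup>2" for i
    using inner_ge_zero[of "v i - m"]
    by (simp add: power2_norm_eq_inner inner_simps inner_commute)
  have "(\<Sum>i\<in>I. u i * (2 * (v i \<bullet> m) - m \<bullet> m)) = 2 * (\<Sum>i\<in>I. u i * (v i \<bullet> m)) - sum u I * (m \<bullet> m)"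
    by (simp add: right_diff_distrib sum_subtractf sum_distrib_left sum_distrib_right ac_simps)
  also have "(\<Sum>i\<in>I. u i * (v i \<bullet> m)) = m \<bullet> m"
    by (simp add: m_def inner_sum_left[of _ I])
  finally have "m \<bullet> m = (\<Sum>i\<in>I. u i * (2 * (v i \<bullet> m) - m \<bullet> m))"
    using assms(1) by simp
  also have "\<dots> \<le> (\<Sum>i\<in>I. u i * (norm (v i))\<^sup>2)"
    by (intro sum_mono mult_left_mono tangent assms(2))
  finally show ?thesis
    by (simp add: m_def power2_norm_eq_inner)
qed

lemma convergent_if_summable_steps:
  fixes x :: "nat \<Rightarrow> 'a::banach"
  assumes "summable (\<lambda>k. dist (x k) (x (Suc k)))"
  shows "convergent x"
proof -
  have "summable (\<lambda>k. x (Suc k) - x k)"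
    by (rule summable_norm_cancel) (use assms in \<open>simp add: dist_norm norm_minus_commute\<close>)
  then have "convergent (\<lambda>n. x n - x 0)"
    by (simp add: summable_iff_convergent sum_lessThan_telescope)
  then show ?thesis
    using convergent_diff_const_right_iff by blast
qed

lemma simplex_full_dimension_contains_cball:
  fixes S :: "'a::euclidean_space set"
  assumes "int DIM('a) simplex S"
  obtains c r where "0 < r" "cball c r \<subseteq> S"
proof -
  have "aff_dim S = int DIM('a)"
    using assms aff_dim_simplex by blast
  then have "rel_interior S = interior S" "S \<noteq> {}"
    by (auto simp: aff_dim_eq_full rel_interior_interior)
  moreover have "convex S"
    using assms by (auto simp: simplex)
  ultimately obtain c where "c \<in> interior S"
    using rel_interior_eq_empty by blast
  then show thesis
    using that by (auto simp: mem_interior_cball)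
qed

section \<open>Paths of successive projections\<close>

primrec path_length :: "(nat \<Rightarrow> 'a::euclidean_space set) \<Rightarrow> nat list \<Rightarrow> 'a \<Rightarrow> real" where
  "path_length C [] q = 0"
| "path_length C (j # \<iota>) q =
     dist q (closest_point (C j) q) + path_length C \<iota> (closest_point (C j) q)"

lemma path_length_nonneg: "0 \<le> path_length C \<iota> q"
  by (induction \<iota> arbitrary: q) auto

lemma dist_proj_comp_le_path_length: "dist q (proj_comp C \<iota> q) \<le> path_length C \<iota> q"
proof (induction \<iota> arbitrary: q)
  case (Cons j \<iota>)
  show ?case
    using Cons[of "closest_point (C j) q"] dist_triangle[of q _ "closest_point (C j) q"]
    by (simp add: proj_comp_def) (smt (verit))
qed (simp add: proj_comp_def)

lemma infdist_le_path_length: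
  assumes "j \<in> set \<iota>" "closed (C j)" "C j \<noteq> {}"
  shows "infdist q (C j) \<le> path_length C \<iota> q"
  using assms(1)
proof (induction \<iota> arbitrary: q)
  case (Cons i \<iota>)
  let ?p = "closest_point (C i) q"
  show ?case
  proof (cases "j = i")
    case True
    then have "infdist q (C j) \<le> dist q ?p"
      using assms by (simp add: closest_point_in_set infdist_le)
    then show ?thesis
      using path_length_nonneg[of C \<iota> ?p] by simp
  next
    case False
    then have "infdist ?p (C j) \<le> path_length C \<iota> ?p"
      using Cons by simp
    then show ?thesis
      using infdist_triangle[of q "C j" ?p] by simp
  qed
qed simp

lemma path_length_decrease:
  assumes "\<And>i. i \<in> set \<iota> \<Longrightarrow> convex (C i) \<and> closed (C i) \<and> cball c r \<subseteq> C i" "0 \<le> r"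
  shows "2 * r * path_length C \<iota> q \<le> (dist q c)\<^sup>2 - (dist (proj_comp C \<iota> q) c)\<^sup>2"
  using assms(1)
proof (induction \<iota> arbitrary: q)
  case (Cons j \<iota>)
  let ?p = "closest_point (C j) q"
  have "2 * r * path_length C \<iota> ?p \<le> (dist ?p c)\<^sup>2 - (dist (proj_comp C \<iota> ?p) c)\<^sup>2"
    using Cons by simp
  moreover have "2 * r * dist q ?p \<le> (dist q c)\<^sup>2 - (dist ?p c)\<^sup>2"
    using Cons.prems assms(2) by (intro closest_point_ball_decrease) auto
  ultimately show ?case
    by (simp add: proj_comp_def distrib_left)
qed (simp add: proj_comp_def)

section \<open>Weighted averages of compositions\<close>

definition mean_proj :: "(nat \<Rightarrow> 'a::euclidean_space set) \<Rightarrow> (nat list \<Rightarrow> real) \<Rightarrow> 'a \<Rightarrow> 'a" where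
  "mean_proj C w q = (\<Sum>\<iota>\<in>support w. w \<iota> *\<^sub>R proj_comp C \<iota> q)"

definition mean_path_length ::
    "(nat \<Rightarrow> 'a::euclidean_space set) \<Rightarrow> (nat list \<Rightarrow> real) \<Rightarrow> 'a \<Rightarrow> real" where
  "mean_path_length C w q = (\<Sum>\<iota>\<in>support w. w \<iota> * path_length C \<iota> q)"

lemma weight_nonneg: "weight_function w \<Longrightarrow> \<iota> \<in> support w \<Longrightarrow> 0 \<le> w \<iota>"
  by (auto simp: weight_function_def support_def)

lemma weight_of_index_nonneg: "weight_function w \<Longrightarrow> 0 \<le> weight_of_index w j"
  unfolding weight_of_index_def by (intro sum_nonneg) (auto intro: weight_nonneg)

lemma mean_path_length_nonneg: "weight_function w \<Longrightarrow> 0 \<le> mean_path_length C w q"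
  unfolding mean_path_length_def
  by (intro sum_nonneg mult_nonneg_nonneg weight_nonneg path_length_nonneg)

lemma mean_proj_minus:
  assumes "weight_function w"
  shows "mean_proj C w q - a = (\<Sum>\<iota>\<in>support w. w \<iota> *\<^sub>R (proj_comp C \<iota> q - a))"
  using assms
  by (simp add: mean_proj_def weight_function_def scaleR_diff_right sum_subtractf
      flip: scaleR_left.sum)

lemma dist_mean_proj_le_mean_path_length:
  assumes "weight_function w"
  shows "dist q (mean_proj C w q) \<le> mean_path_length C w q"
proof -
  have "dist q (mean_proj C w q) \<le> (\<Sum>\<iota>\<in>support w. norm (w \<iota> *\<^sub>R (proj_comp C \<iota> q - q)))"
    by (simp add: dist_norm norm_minus_commute[of q] mean_proj_minus[OF assms] norm_sum del: norm_scaleR)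
  also have "\<dots> \<le> mean_path_length C w q"
    unfolding mean_path_length_def
    using assms dist_proj_comp_le_path_length[of q C]
    by (intro sum_mono)
       (auto intro!: mult_left_mono simp: weight_nonneg dist_norm norm_minus_commute)
  finally show ?thesis .
qed

text \<open>Index vectors that avoid \<open>j\<close> contribute nonnegative terms to the mean path length, the
  others at least the distance to \<open>C j\<close> each.\<close>

lemma weight_of_index_infdist_le_mean_path_length:
  assumes "weight_function w" "closed (C j)" "C j \<noteq> {}"
  shows "weight_of_index w j * infdist q (C j) \<le> mean_path_length C w q"
proof -
  have "weight_of_index w j * infdist q (C j)
      \<le> (\<Sum>\<iota>\<in>support w \<inter> index_vectors_with j. w \<iota> * path_length C \<iota> q)"
    unfolding weight_of_index_def sum_distrib_right using assms
    by (intro sum_mono mult_left_mono infdist_le_path_length)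
       (auto simp: index_vectors_with_def weight_nonneg)
  also have "\<dots> \<le> mean_path_length C w q"
    unfolding mean_path_length_def
  proof (rule sum_mono2)
    show "finite (support w)"
      using assms(1) by (simp add: weight_function_def)
  qed (auto intro: mult_nonneg_nonneg weight_nonneg[OF assms(1)] path_length_nonneg)
  finally show ?thesis .
qed

section \<open>The iteration\<close>

locale projection_iteration =
  fixes C :: "nat \<Rightarrow> 'a::euclidean_space set" and w :: "nat \<Rightarrow> nat list \<Rightarrow> real"
    and x :: "nat \<Rightarrow> 'a" and c :: 'a and r :: real
  assumes closed: "i \<in> indices \<Longrightarrow> closed (C i)"
    and convex: "i \<in> indices \<Longrightarrow> convex (C i)"
    and weight: "weight_function (w k)"
    and step: "x (Suc k) = mean_proj C (w k) (x k)"
    and radius: "0 < r"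
    and cball: "i \<in> indices \<Longrightarrow> cball c r \<subseteq> C i"
begin

text \<open>The squared distance of the mean to \<open>c\<close> is at most the mean of the squared distances, so
  the decrease along the single paths may be averaged.\<close>

lemma step_decrease:
  "2 * r * mean_path_length C (w k) (x k) \<le> (dist (x k) c)\<^sup>2 - (dist (x (Suc k)) c)\<^sup>2"
proof -
  let ?W = "support (w k)" and ?p = "\<lambda>\<iota>. proj_comp C \<iota> (x k)"
  have sum1: "sum (w k) ?W = 1"
    using weight by (simp add: weight_function_def)
  have "2 * r * path_length C \<iota> (x k) \<le> (dist (x k) c)\<^sup>2 - (dist (?p \<iota>) c)\<^sup>2" if "\<iota> \<in> ?W" for \<iota>
  proof (rule path_length_decrease)
    fix i assume "i \<in> set \<iota>"
    then have "i \<in> indices"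
      using that by (auto simp: support_def index_vectors_def)
    then show "convex (C i) \<and> closed (C i) \<and> cball c r \<subseteq> C i"
      using closed convex cball by blast
  qed (use radius in simp)
  then have "(\<Sum>\<iota>\<in>?W. w k \<iota> * (2 * r * path_length C \<iota> (x k)))
      \<le> (\<Sum>\<iota>\<in>?W. w k \<iota> * ((dist (x k) c)\<^sup>2 - (dist (?p \<iota>) c)\<^sup>2))"
    by (intro sum_mono mult_left_mono weight_nonneg[OF weight])
  also have "\<dots> = (dist (x k) c)\<^sup>2 - (\<Sum>\<iota>\<in>?W. w k \<iota> * (norm (?p \<iota> - c))\<^sup>2)"
    using sum1 by (simp add: right_diff_distrib sum_subtractf dist_norm flip: sum_distrib_right)
  also have "\<dots> \<le> (dist (x k) c)\<^sup>2 - (dist (x (Suc k)) c)\<^sup>2"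
    using norm_convex_combination_power2_le[OF sum1 weight_nonneg[OF weight], of "\<lambda>\<iota>. ?p \<iota> - c"]
    by (simp add: dist_norm step mean_proj_minus[OF weight])
  finally show ?thesis
    by (simp add: mean_path_length_def sum_distrib_left ac_simps)
qed

lemma mean_path_length_summable: "summable (\<lambda>k. mean_path_length C (w k) (x k))"
proof (rule bounded_imp_summable)
  show "0 \<le> mean_path_length C (w k) (x k)" for k
    by (rule mean_path_length_nonneg[OF weight])
  show "(\<Sum>k\<le>n. mean_path_length C (w k) (x k)) \<le> (dist (x 0) c)\<^sup>2 / (2 * r)" for n
  proof -
    have "2 * r * (\<Sum>k\<le>n. mean_path_length C (w k) (x k))
        \<le> (\<Sum>k\<le>n. (dist (x k) c)\<^sup>2 - (dist (x (Suc k)) c)\<^sup>2)"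
      unfolding sum_distrib_left by (intro sum_mono step_decrease)
    also have "\<dots> \<le> (dist (x 0) c)\<^sup>2"
      using sum_telescope[of "\<lambda>k. (dist (x k) c)\<^sup>2" n] by simp
    finally show ?thesis
      using radius by (simp add: field_simps)
  qed
qed

lemma iterates_convergent: "convergent x"
proof (rule convergent_if_summable_steps)
  show "summable (\<lambda>k. dist (x k) (x (Suc k)))"
    by (rule summable_comparison_test'[OF mean_path_length_summable])
       (simp add: step dist_mean_proj_le_mean_path_length weight)
qed

lemma limit_mem_if_weight_diverges:
  assumes "x \<longlonglongrightarrow> l" "j \<in> indices" "(\<Sum>k. ennreal (weight_of_index (w k) j)) = \<infinity>"
  shows "l \<in> C j"
proof (rule ccontr)
  assume "l \<notin> C j"
  have cl: "closed (C j)" and ne: "C j \<noteq> {}"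
    using assms(2) closed cball[OF assms(2)] radius by auto
  define d where "d = infdist l (C j) / 2"
  have "0 < infdist l (C j)"
    using infdist_pos_not_in_closed[OF cl ne \<open>l \<notin> C j\<close>] .
  then have "0 < d" "d < infdist l (C j)"
    by (auto simp: d_def)
  then have "\<forall>\<^sub>F k in sequentially. d < infdist (x k) (C j)"
    using tendsto_infdist[OF assms(1), of "C j"] order_tendstoD(1) by blast
  then have "\<forall>\<^sub>F k in sequentially.
      norm (weight_of_index (w k) j * d) \<le> mean_path_length C (w k) (x k)"
  proof eventually_elim
    case (elim k)
    have "weight_of_index (w k) j * d \<le> weight_of_index (w k) j * infdist (x k) (C j)"
      using elim by (intro mult_left_mono weight_of_index_nonneg weight) auto
    also have "\<dots> \<le> mean_path_length C (w k) (x k)"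
      using weight cl ne by (rule weight_of_index_infdist_le_mean_path_length)
    finally show ?case
      using \<open>0 < d\<close> weight_of_index_nonneg[OF weight] by simp
  qed
  then have "summable (\<lambda>k. weight_of_index (w k) j * d)"
    using mean_path_length_summable by (rule summable_comparison_test_ev)
  then have "summable (\<lambda>k. weight_of_index (w k) j)"
    using \<open>0 < d\<close> summable_cmult_iff[of d] by (simp add: mult.commute)
  then have "(\<Sum>k. ennreal (weight_of_index (w k) j)) \<noteq> \<infinity>"
    using ennreal_suminf_neq_top weight_of_index_nonneg[OF weight] by simp
  then show False
    using assms(3) by contradiction
qed

end

section \<open>Convergence of the weighted projection method\<close>

theorem theorem2p1:
  fixes C :: "nat \<Rightarrow> (real ^ 'n) set"
    and w :: "nat \<Rightarrow> nat list \<Rightarrow> real"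
    and x :: "nat \<Rightarrow> real ^ 'n"
  assumes "\<And>i. i \<in> indices \<Longrightarrow> closed (C i)"
    and "\<And>i. i \<in> indices \<Longrightarrow> convex (C i)"
    and "(\<Inter>i\<in>indices. C i) \<noteq> {}"
    and "\<exists>i\<in>indices. C i \<noteq> UNIV"
    and "\<And>k. weight_function (w k)"
    and "\<And>k. x (Suc k) = (\<Sum>\<iota>\<in>support (w k). w k \<iota> *\<^sub>R proj_comp C \<iota> (x k))"
    and "\<exists>S. int CARD('n) simplex S \<and> S \<subseteq> (\<Inter>i\<in>indices. C i)"
  shows "(\<exists>l. x \<longlonglongrightarrow> l \<and>
            (\<forall>j\<in>indices. (\<Sum>k. ennreal (weight_of_index (w k) j)) = \<infinity> \<longrightarrow> l \<in> C j)) \<and>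
         ((\<forall>j\<in>indices. C j \<noteq> UNIV \<longrightarrow> (\<Sum>k. ennreal (weight_of_index (w k) j)) = \<infinity>) \<longrightarrow>
            (\<exists>l\<in>(\<Inter>i\<in>indices. C i). x \<longlonglongrightarrow> l))"
proof -
  obtain S where "int CARD('n) simplex S" and sub: "S \<subseteq> (\<Inter>i\<in>indices. C i)"
    using assms(7) by blast
  then have "int DIM(real ^ 'n) simplex S"
    by simp
  then obtain c r where "0 < r" "cball c r \<subseteq> S"
    by (rule simplex_full_dimension_contains_cball)
  with sub have ball: "cball c r \<subseteq> C i" if "i \<in> indices" for i
    using that by blast
  have step: "x (Suc k) = mean_proj C (w k) (x k)" for k
    unfolding mean_proj_def by (rule assms(6))
  interpret projection_iteration C w x c r
    by (rule projection_iteration.intro) (fact assms(1,2,5) step \<open>0 < r\<close> ball)+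
  obtain l where l: "x \<longlonglongrightarrow> l"
    using iterates_convergent by (auto simp: convergent_def)
  then have "\<forall>j\<in>indices. (\<Sum>k. ennreal (weight_of_index (w k) j)) = \<infinity> \<longrightarrow> l \<in> C j"
    using limit_mem_if_weight_diverges by blast
  \<comment> \<open>In the second part, sets that are the whole space contain \<open>l\<close> trivially.\<close>
  with l show ?thesis
    by blast
qed

end
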